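(* Let $J_n$ be a jury of odd size $n$ whose jurors have individual error rates $\epsilon_1, \dots, \epsilon_n \in (0,1)$. Put $\mu = \sum_{i=1}^{n} \epsilon_i$, $\sigma^2 = \sum_{i=1}^{n} (1-\epsilon_i)\epsilon_i$ and $\gamma = \frac{(n+1)/2}{\mu}$, and suppose $\gamma \in (0,1)$. Then $$JER(J_n) \ge \frac{(1-\gamma)^2\mu^2}{(1-\gamma)^2\mu^2 + \sigma^2}.$$
   Context: A jury $J_n=\{j_1,\dots,j_n\}$ is a set of $n$ jurors, $n$ odd. Individual error rate $\epsilon_i$ is the probability that juror $j_i$ votes wrongly; jurors err independently. The jury error rate under majority voting is the probability that at least $\frac{n+1}{2}$ of the jurors vote wrongly: $$JER(J_n) = \sum_{k=\frac{n+1}{2}}^{n} \ \sum_{A \subseteq \{1,\dots,n\},\ |A| = k} \ \prod_{i \in A} \epsilon_i \prod_{i \notin A} (1-\epsilon_i).$$ *)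

theory Defs
  imports Complex_Main
begin

text \<open>The sum over \<open>A\<close> is the probability of exactly \<open>k\<close> wrong votes: independent
  jurors \<open>1, \<dots>, n\<close> err with probabilities \<open>\<epsilon> 1, \<dots>, \<epsilon> n\<close>, and \<open>A\<close> is the set of jurors
  that vote wrongly. For odd \<open>n\<close> the natural-number division is exact.\<close>

definition JER :: "nat \<Rightarrow> (nat \<Rightarrow> real) \<Rightarrow> real" where
  "JER n \<epsilon> = (\<Sum>k = (n + 1) div 2..n. \<Sum>A | A \<subseteq> {1..n} \<and> card A = k.
     (\<Prod>i\<in>A. \<epsilon> i) * (\<Prod>i\<in>{1..n} - A. 1 - \<epsilon> i))"

end

theory Submission
  imports Defs
begin

text \<open>This is Cantelli's one-sided Chebyshev inequality for the number \<open>X\<close> of wrong votes, which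
  has mean \<open>\<mu>\<close> and variance \<open>\<sigma>\<^sup>2\<close>. Put \<open>a = (1 - \<gamma>) * \<mu> = \<mu> - (n + 1) / 2 > 0\<close>. For every
  \<open>t \<ge> 0\<close> the indicator of \<open>X \<ge> \<mu> - a\<close> is at least \<open>1 - (X - \<mu> - t)\<^sup>2 / (t + a)\<^sup>2\<close>, whose expectation
  is \<open>1 - (\<sigma>\<^sup>2 + t\<^sup>2) / (t + a)\<^sup>2\<close>. The choice \<open>t = \<sigma>\<^sup>2 / a\<close> is optimal.\<close>

text \<open>The probability that \<open>A\<close> is exactly the set of wrong voters, over any juror
  set \<open>S\<close> instead of \<open>{1..n}\<close> so that induction on \<open>S\<close> is
  available.\<close>

definition vote_prob :: "('a \<Rightarrow> real) \<Rightarrow> 'a set \<Rightarrow> 'a set \<Rightarrow> real" where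
  "vote_prob p S A = (\<Prod>i\<in>A. p i) * (\<Prod>i\<in>S - A. 1 - p i)"

lemma vote_prob_nonneg:
  assumes "\<And>i. i \<in> S \<Longrightarrow> 0 \<le> p i \<and> p i \<le> 1" "A \<subseteq> S"
  shows "0 \<le> vote_prob p S A"
  unfolding vote_prob_def using assms by (intro mult_nonneg_nonneg prod_nonneg) auto

text \<open>Conditioning on the vote of \<open>x\<close>, which is independent of the others.
  Keeping \<open>f\<close> arbitrary lets one recursion serve both the total mass and the second
  moment.\<close>

lemma sum_vote_prob_insert:
  assumes "finite S" "x \<notin> S"
  shows "(\<Sum>A\<in>Pow (insert x S). vote_prob p (insert x S) A * f A) =
    p x * (\<Sum>A\<in>Pow S. vote_prob p S A * f (insert x A)) +
    (1 - p x) * (\<Sum>A\<in>Pow S. vote_prob p S A * f A)"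
proof -
  have disj: "Pow S \<inter> insert x ` Pow S = {}" and inj: "inj_on (insert x) (Pow S)"
    using assms(2) by (auto simp: inj_on_def)
  have wrong: "vote_prob p (insert x S) (insert x A) = p x * vote_prob p S A"
    and right: "vote_prob p (insert x S) A = (1 - p x) * vote_prob p S A" if "A \<in> Pow S" for A
  proof -
    have "finite A" "x \<notin> A" "insert x S - insert x A = S - A"
      "insert x S - A = insert x (S - A)"
      using that assms finite_subset by auto
    then show "vote_prob p (insert x S) (insert x A) = p x * vote_prob p S A"
      and "vote_prob p (insert x S) A = (1 - p x) * vote_prob p S A"
      using assms by (simp_all add: vote_prob_def)
  qed
  show ?thesis
    using assms(1) disj
    by (simp add: Pow_insert sum.union_disjoint sum.reindex[OF inj] wrong right
        sum_distrib_left mult.assoc)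
qed

lemma sum_vote_prob:
  assumes "finite S"
  shows "(\<Sum>A\<in>Pow S. vote_prob p S A) = 1"
  using assms
proof (induction S)
  case empty
  then show ?case by (simp add: vote_prob_def)
next
  case (insert x S)
  then show ?case using sum_vote_prob_insert[of S x p "\<lambda>_. 1"] by simp
qed

text \<open>Variance plus squared bias about \<open>c\<close>. A wrong vote of \<open>x\<close>
  raises the count by one, which amounts to moving the centre to \<open>c - 1\<close>; hence the
  induction needs \<open>c\<close> arbitrary.\<close>

lemma second_moment_vote_prob:
  assumes "finite S"
  shows "(\<Sum>A\<in>Pow S. vote_prob p S A * (real (card A) - c)\<^sup>2) =
    (\<Sum>i\<in>S. (1 - p i) * p i) + ((\<Sum>i\<in>S. p i) - c)\<^sup>2"
  using assms
proof (induction S arbitrary: c)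
  case empty
  then show ?case by (simp add: vote_prob_def)
next
  case (insert x S)
  have "(\<Sum>A\<in>Pow S. vote_prob p S A * (real (card (insert x A)) - c)\<^sup>2) =
      (\<Sum>A\<in>Pow S. vote_prob p S A * (real (card A) - (c - 1))\<^sup>2)"
  proof (rule sum.cong[OF refl])
    fix A assume "A \<in> Pow S"
    then have "card (insert x A) = Suc (card A)"
      using insert.hyps finite_subset by (subst card_insert_disjoint) auto
    then show "vote_prob p S A * (real (card (insert x A)) - c)\<^sup>2 =
        vote_prob p S A * (real (card A) - (c - 1))\<^sup>2"
      by (simp add: algebra_simps)
  qed
  \<comment> \<open>With \<open>d\<close> the mean over \<open>S\<close> minus \<open>c\<close>, and
    \<open>q = p x\<close>, what remains is
    \<open>q * (d + 1)^2 + (1 - q) * d^2 = (d + q)^2 + (1 - q) * q\<close>.\<close>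
  then show ?case
    using insert by (simp add: sum_vote_prob_insert) (simp add: power2_eq_square algebra_simps)
qed

text \<open>Grouping the sets by cardinality gives the double sum; its upper limit \<open>n\<close>
  excludes nothing, since no subset of \<open>{1..n}\<close> is larger.\<close>

lemma JER_eq_sum_vote_prob:
  "JER n \<epsilon> = (\<Sum>A | A \<subseteq> {1..n} \<and> (n + 1) div 2 \<le> card A. vote_prob \<epsilon> {1..n} A)"
proof -
  let ?T = "{A. A \<subseteq> {1..n} \<and> (n + 1) div 2 \<le> card A}"
  have "finite ?T"
    by (rule finite_subset[of _ "Pow {1..n}"]) auto
  moreover have "card ` ?T \<subseteq> {(n + 1) div 2..n}"
    using card_mono[of "{1..n}"] by fastforce
  ultimately have "(\<Sum>A\<in>?T. vote_prob \<epsilon> {1..n} A) =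
      (\<Sum>k = (n + 1) div 2..n. \<Sum>A | A \<in> ?T \<and> card A = k. vote_prob \<epsilon> {1..n} A)"
    by (intro sum.group[symmetric]) auto
  also have "\<dots> = JER n \<epsilon>"
    unfolding JER_def vote_prob_def by (intro sum.cong) auto
  finally show ?thesis by simp
qed

lemma cantelli_vote_prob:
  assumes "finite S" and p: "\<And>i. i \<in> S \<Longrightarrow> 0 \<le> p i \<and> p i \<le> 1" and "0 < a"
  defines "\<mu> \<equiv> \<Sum>i\<in>S. p i" and "v \<equiv> \<Sum>i\<in>S. (1 - p i) * p i"
  shows "a\<^sup>2 / (a\<^sup>2 + v) \<le> (\<Sum>A | A \<subseteq> S \<and> \<mu> - a \<le> real (card A). vote_prob p S A)"
proof -
  define t where "t = v / a"
  have "0 \<le> v"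
    unfolding v_def using p by (intro sum_nonneg mult_nonneg_nonneg) auto
  then have "0 \<le> t" using \<open>0 < a\<close> by (simp add: t_def)
  have v: "v = t * a" using \<open>0 < a\<close> by (simp add: t_def)
  have "a\<^sup>2 / (a\<^sup>2 + v) = a / (a + t)"
  proof -
    have "a\<^sup>2 + v = a * (a + t)" by (simp add: v power2_eq_square algebra_simps)
    then show ?thesis using \<open>0 < a\<close> by (simp add: power2_eq_square)
  qed
  \<comment> \<open>Since \<open>v = t * a\<close>, the numerator \<open>v + t\<^sup>2\<close>
    factors as \<open>t * (t + a)\<close>.\<close>
  also have "\<dots> = 1 - (v + t\<^sup>2) / (t + a)\<^sup>2"
    using \<open>0 < a\<close> \<open>0 \<le> t\<close> by (simp add: v divide_simps) (simp add: power2_eq_square algebra_simps)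
  also have "\<dots> = (\<Sum>A\<in>Pow S. vote_prob p S A) -
      (\<Sum>A\<in>Pow S. vote_prob p S A * (real (card A) - (\<mu> + t))\<^sup>2) / (t + a)\<^sup>2"
    using second_moment_vote_prob[OF \<open>finite S\<close>, of p "\<mu> + t"] sum_vote_prob[OF \<open>finite S\<close>, of p]
    by (simp add: \<mu>_def v_def)
  also have "\<dots> = (\<Sum>A\<in>Pow S. vote_prob p S A * (1 - (real (card A) - (\<mu> + t))\<^sup>2 / (t + a)\<^sup>2))"
    by (simp add: right_diff_distrib sum_subtractf sum_divide_distrib)
  also have "\<dots> \<le> (\<Sum>A\<in>Pow S. if \<mu> - a \<le> real (card A) then vote_prob p S A else 0)"
  proof (rule sum_mono)
    fix A assume "A \<in> Pow S"
    then have w: "0 \<le> vote_prob p S A" using vote_prob_nonneg[of S p A] p by auto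
    let ?q = "(real (card A) - (\<mu> + t))\<^sup>2 / (t + a)\<^sup>2"
    show "vote_prob p S A * (1 - ?q) \<le> (if \<mu> - a \<le> real (card A) then vote_prob p S A else 0)"
    proof (cases "\<mu> - a \<le> real (card A)")
      case True
      then show ?thesis using w by (simp add: mult_left_le)
    next
      case False
      \<comment> \<open>Here \<open>card A\<close> is more than \<open>a\<close> below
        \<open>\<mu>\<close>, so more than \<open>t + a\<close> below \<open>\<mu> + t\<close>,
        where the parabola \<open>1 - ?q\<close> is no longer positive.\<close>
      then have "(t + a)\<^sup>2 \<le> (\<mu> + t - real (card A))\<^sup>2"
        using \<open>0 < a\<close> \<open>0 \<le> t\<close> by (intro power_mono) auto
      then have "1 \<le> ?q"
        using \<open>0 < a\<close> \<open>0 \<le> t\<close> by (simp add: power2_commute[of "\<mu> + t"])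
      then show ?thesis using False w by (simp add: mult_nonneg_nonpos)
    qed
  qed
  also have "\<dots> = (\<Sum>A | A \<subseteq> S \<and> \<mu> - a \<le> real (card A). vote_prob p S A)"
    using \<open>finite S\<close> by (simp flip: sum.inter_filter)
  finally show ?thesis .
qed

theorem lemma2:
  fixes n :: nat and \<epsilon> :: "nat \<Rightarrow> real" and \<mu> \<sigma> \<gamma> :: real
  assumes "odd n"
    and "\<And>i. i \<in> {1..n} \<Longrightarrow> \<epsilon> i \<in> {0<..<1}"
    and "\<mu> = (\<Sum>i = 1..n. \<epsilon> i)"
    and "\<sigma>\<^sup>2 = (\<Sum>i = 1..n. (1 - \<epsilon> i) * \<epsilon> i)"
    and "\<gamma> = ((real n + 1) / 2) / \<mu>"
    and "\<gamma> \<in> {0<..<1}"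
  shows "JER n \<epsilon> \<ge> ((1 - \<gamma>)\<^sup>2 * \<mu>\<^sup>2) / ((1 - \<gamma>)\<^sup>2 * \<mu>\<^sup>2 + \<sigma>\<^sup>2)"
proof -
  define a where "a = (1 - \<gamma>) * \<mu>"
  \<comment> \<open>The positive numerator of \<open>\<gamma>\<close> forces this;
    \<open>\<mu> = 0\<close> would give \<open>\<gamma> = 0\<close> by the convention for
    division.\<close>
  have "0 < \<mu>"
    using assms(5,6) by (simp add: zero_less_divide_iff)
  then have "0 < a" and \<gamma>\<mu>: "\<mu> - a = (real n + 1) / 2"
    using assms(6) by (simp_all add: a_def left_diff_distrib assms(5))
  \<comment> \<open>For odd \<open>n\<close> the real number \<open>(n + 1) / 2\<close> is an
    integer, so the real and the natural-number thresholds agree.\<close>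
  have threshold: "(real n + 1) / 2 \<le> real k \<longleftrightarrow> (n + 1) div 2 \<le> k" for k
    using \<open>odd n\<close> by (auto elim!: oddE)
  have "a\<^sup>2 / (a\<^sup>2 + \<sigma>\<^sup>2) \<le>
      (\<Sum>A | A \<subseteq> {1..n} \<and> \<mu> - a \<le> real (card A). vote_prob \<epsilon> {1..n} A)"
    unfolding assms(3,4) using assms(2) \<open>0 < a\<close>
    by (intro cantelli_vote_prob) (auto simp: less_imp_le)
  then show ?thesis
    unfolding \<gamma>\<mu> threshold JER_eq_sum_vote_prob by (simp add: a_def power_mult_distrib)
qed

end
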